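(* For every Sturmian word $\omega$ and every positive integer $k$, there exist two positive integers $\ell_1$ and $\ell_2$ such that at each position of $\omega$ there begins an occurrence of an Abelian $k$-power with Abelian period $\ell_1$ or $\ell_2$. In particular, every Sturmian word begins in an Abelian $k$-power for all positive integers $k$.
   Context: A Sturmian word is a right-infinite word over $\{0,1\}$ that is aperiodic (not ultimately periodic) and balanced, i.e. $\bigl||U|_a-|V|_a\bigr|\le 1$ for each letter $a$ and all factors (finite blocks of consecutive letters) $U,V$ of equal length, where $|U|_a$ is the number of occurrences of $a$ in $U$. Two finite words $u,v$ are Abelian equivalent if $|u|_a=|v|_a$ for all letters $a$. An Abelian $k$-power is a non-empty word of the form $u_1u_2\cdots u_k$ with $u_1,\dots,u_k$ pairwise Abelian equivalent; such a word is said to have Abelian period $|u_1|$. A word begins in an Abelian $k$-power if some prefix of it is an Abelian $k$-power. *)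

theory Defs
  imports "HOL-Library.Omega_Words_Fun"
begin

text \<open>Finite words are lists and right-infinite words are functions on \<^typ>\<open>nat\<close>, so positions are
  counted from 0. The binary alphabet is the set \<open>{0, 1}\<close> of natural numbers.\<close>

definition factor_of :: "'a list \<Rightarrow> 'a word \<Rightarrow> bool" where
  "factor_of u w \<longleftrightarrow> (\<exists>i j. u = w [i \<rightarrow> j])"

definition occurs_at :: "'a list \<Rightarrow> 'a word \<Rightarrow> nat \<Rightarrow> bool" where
  "occurs_at u w n \<longleftrightarrow> w [n \<rightarrow> n + length u] = u"

definition ultimately_periodic :: "'a word \<Rightarrow> bool" where
  "ultimately_periodic w \<longleftrightarrow> (\<exists>p>0. \<exists>N. \<forall>n\<ge>N. w (n + p) = w n)"

definition balanced :: "nat word \<Rightarrow> bool" where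
  "balanced w \<longleftrightarrow>
     (\<forall>a\<in>{0, 1}. \<forall>U V. factor_of U w \<longrightarrow> factor_of V w \<longrightarrow> length U = length V \<longrightarrow>
        \<bar>int (count_list U a) - int (count_list V a)\<bar> \<le> 1)"

definition sturmian :: "nat word \<Rightarrow> bool" where
  "sturmian w \<longleftrightarrow> range w \<subseteq> {0, 1} \<and> \<not> ultimately_periodic w \<and> balanced w"

definition abelian_equivalent :: "'a list \<Rightarrow> 'a list \<Rightarrow> bool" where
  "abelian_equivalent u v \<longleftrightarrow> (\<forall>a. count_list u a = count_list v a)"

definition abelian_factorization :: "nat \<Rightarrow> 'a list list \<Rightarrow> 'a list \<Rightarrow> bool" where
  "abelian_factorization k us x \<longleftrightarrow>
     length us = k \<and> x = concat us \<and> (\<forall>u\<in>set us. \<forall>v\<in>set us. abelian_equivalent u v)"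

definition abelian_power :: "nat \<Rightarrow> 'a list \<Rightarrow> bool" where
  "abelian_power k x \<longleftrightarrow> x \<noteq> [] \<and> (\<exists>us. abelian_factorization k us x)"

text \<open>The period belongs to a factorization into \<open>k\<close> blocks. As \<open>x\<close> is non-empty, so is the list
  of blocks, and \<^term>\<open>hd us\<close> is the first block.\<close>

definition abelian_power_period :: "nat \<Rightarrow> nat \<Rightarrow> 'a list \<Rightarrow> bool" where
  "abelian_power_period k l x \<longleftrightarrow>
     x \<noteq> [] \<and> (\<exists>us. abelian_factorization k us x \<and> length (hd us) = l)"

definition begins_in_abelian_power :: "nat \<Rightarrow> 'a word \<Rightarrow> bool" where
  "begins_in_abelian_power k w \<longleftrightarrow> (\<exists>n. abelian_power k (prefix n w))"

end

theory Submission
  imports Defs "HOL-Analysis.Kronecker_Approximation_Theorem"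
begin

text \<open>
  Over a binary alphabet, blocks of equal length are Abelian equivalent as soon as they contain
  equally many ones, so the proof only counts ones. In a balanced word the number of ones in a
  window of length \<open>l\<close> takes at most two consecutive values, and comparing windows of
  different lengths yields a slope \<open>\<alpha>\<close> with \<open>l * \<alpha>\<close> between these values for every \<open>l\<close>
  (lemma \<open>balanced_imp_has_slope\<close>). Consequently the discrepancy
  \<open>D n = (ones among the first n letters) - n * \<alpha>\<close> oscillates by at most 1. Aperiodicity makes
  \<open>\<alpha>\<close> irrational (lemma \<open>rational_slope_imp_ultimately_periodic\<close>), so a window of length \<open>l > 0\<close>
  has \<open>\<lfloor>l * \<alpha>\<rfloor>\<close> ones (a light window) or one more (a heavy window). Crossing a light
  window lowers \<open>D\<close> by \<open>frac (l * \<alpha>)\<close>; crossing a heavy one raises it by \<open>1 - frac (l * \<alpha>)\<close>.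

  By density of the fractional parts, choose \<open>l1\<close> with \<open>frac (l1 * \<alpha>) < 1 / (2 * k)\<close> and \<open>l2\<close>
  with \<open>1 - frac (l2 * \<alpha>) < 1 / (2 * k)\<close>. If the \<open>k\<close> blocks of length \<open>l1\<close> starting at
  position \<open>n\<close> do not all have the same number of ones, one of them is heavy; the other blocks
  lower \<open>D\<close> only slightly, so \<open>D\<close> reaches a value above \<open>D n + 1/2\<close>. If the same happens for
  \<open>l2\<close>, one block is light and \<open>D\<close> reaches a value below \<open>D n - 1/2\<close>. Both together contradict
  the bound on the oscillation, so at each \<open>n\<close> at least one of the two lengths is a period.

  In terms of the rotation by \<open>\<alpha>\<close> that generates the word, the starting points that are bad for
  \<open>l1\<close> and those that are bad for \<open>l2\<close> lie in disjoint intervals of the circle, on the two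
  sides of one point. The discrepancy expresses this without the coding of the word by a rotation.
\<close>

section \<open>Counting ones in windows\<close>

definition ones :: "nat word \<Rightarrow> nat \<Rightarrow> nat \<Rightarrow> nat" where
  "ones w m l = count_list (w [m \<rightarrow> m + l]) 1"

lemma ones_0 [simp]: "ones w m 0 = 0"
  by (simp add: ones_def subsequence_def)

lemma ones_add: "ones w m (l + l') = ones w m l + ones w (m + l) l'"
  using upt_add_eq_append [of m "m + l" l']
  by (simp add: ones_def subsequence_def add.assoc)

lemma ones_Suc_0: "ones w m (Suc 0) = (if w m = 1 then 1 else 0)"
  by (simp add: ones_def)

lemma ones_blocks_le:
  assumes "\<And>m. ones w m l \<le> c"
  shows "ones w m (j * l) \<le> j * c"
proof (induction j)
  case (Suc j)
  have "ones w m (Suc j * l) = ones w m (j * l) + ones w (m + j * l) l"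
    by (metis add.commute mult_Suc ones_add)
  then show ?case using Suc assms [of "m + j * l"] by simp
qed simp

lemma ones_blocks_ge:
  assumes "\<And>m. c \<le> ones w m l"
  shows "j * c \<le> ones w m (j * l)"
proof (induction j)
  case (Suc j)
  have "ones w m (Suc j * l) = ones w m (j * l) + ones w (m + j * l) l"
    by (metis add.commute mult_Suc ones_add)
  then show ?case using Suc assms [of "m + j * l"] by simp
qed simp

lemma balanced_ones_two_values:
  assumes "balanced w"
  obtains c where "\<And>m. c \<le> ones w m l" "\<And>m. ones w m l \<le> c + 1"
proof -
  define c where "c = (LEAST c. \<exists>m. ones w m l = c)"
  have "\<exists>m. ones w m l = c"
    unfolding c_def by (rule LeastI_ex) blast
  then obtain m0 where m0: "ones w m0 l = c" ..
  have "c \<le> ones w m l" for m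
    unfolding c_def by (rule Least_le) blast
  moreover have "ones w m l \<le> c + 1" for m
  proof -
    have "factor_of (w [i \<rightarrow> i + l]) w" for i
      unfolding factor_of_def by blast
    then have "\<bar>int (ones w m l) - int (ones w m0 l)\<bar> \<le> 1"
      using assms unfolding balanced_def ones_def by simp
    then show ?thesis using m0 by linarith
  qed
  ultimately show ?thesis using that by blast
qed

section \<open>The slope and its discrepancy\<close>

text \<open>Beyond the bound \<open>\<bar>ones w m l - l * \<alpha>\<bar> \<le> 1\<close>, the shared \<open>c\<close> records that all windows of one
  length deviate from \<open>l * \<alpha>\<close> within the same unit interval. This is what excludes deviations
  of both signs when \<open>l * \<alpha>\<close> is an integer.\<close>

definition has_slope :: "nat word \<Rightarrow> real \<Rightarrow> bool" where
  "has_slope w \<alpha> \<longleftrightarrow> (\<forall>l. \<exists>c. (\<forall>m. c \<le> ones w m l \<and> ones w m l \<le> c + 1) \<and>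
     real c \<le> real l * \<alpha> \<and> real l * \<alpha> \<le> real c + 1)"

text \<open>Let \<open>c l\<close> be the lower of the two values for length \<open>l\<close>. A window of length \<open>l * m\<close> can be
  cut into \<open>m\<close> windows of length \<open>l\<close> or into \<open>l\<close> windows of length \<open>m\<close>, whence
  \<open>m * c l \<le> l * (c m + 1)\<close>. Every \<open>c l / l\<close> is thus at most every \<open>(c m + 1) / m\<close>, and
  the supremum of the former separates the two families.\<close>

lemma balanced_imp_has_slope:
  assumes "balanced w"
  obtains \<alpha> where "has_slope w \<alpha>"
proof -
  have "\<forall>l. \<exists>c. (\<forall>m. c \<le> ones w m l) \<and> (\<forall>m. ones w m l \<le> c + 1)"
    using balanced_ones_two_values [OF assms] by metis
  then obtain c where c: "\<And>l m. c l \<le> ones w m l" "\<And>l m. ones w m l \<le> c l + 1"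
    by metis
  have le: "real (c l) / real l \<le> (real (c m) + 1) / real m" if "l > 0" "m > 0" for l m
  proof -
    have "m * c l \<le> ones w 0 (m * l)"
      using c(1) by (rule ones_blocks_ge)
    also have "\<dots> = ones w 0 (l * m)"
      by (simp add: mult.commute)
    also have "\<dots> \<le> l * (c m + 1)"
      using c(2) by (rule ones_blocks_le)
    finally have "real (m * c l) \<le> real (l * (c m + 1))"
      by (simp only: of_nat_le_iff)
    then show ?thesis
      using that by (simp add: field_simps)
  qed
  define \<alpha> where "\<alpha> = (SUP l\<in>{0<..}. real (c l) / real l)"
  have lower: "real (c l) / real l \<le> \<alpha>" if "l > 0" for l
    unfolding \<alpha>_def
    by (rule cSUP_upper) (use that le [of _ 1] in \<open>auto intro!: bdd_aboveI2\<close>)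
  have upper: "\<alpha> \<le> (real (c m) + 1) / real m" if "m > 0" for m
    unfolding \<alpha>_def by (rule cSUP_least) (use that le in auto)
  have "real (c l) \<le> real l * \<alpha> \<and> real l * \<alpha> \<le> real (c l) + 1" for l
  proof (cases "l = 0")
    case True
    then show ?thesis using c(1) [of 0 0] by simp
  next
    case False
    then show ?thesis using lower [of l] upper [of l] by (simp add: field_simps)
  qed
  then show ?thesis
    using that c unfolding has_slope_def by blast
qed

definition discrepancy :: "real \<Rightarrow> nat word \<Rightarrow> nat \<Rightarrow> real" where
  "discrepancy \<alpha> w n = real (ones w 0 n) - real n * \<alpha>"

lemma discrepancy_add:
  "discrepancy \<alpha> w (m + l) = discrepancy \<alpha> w m + (real (ones w m l) - real l * \<alpha>)"
  by (simp add: discrepancy_def ones_add distrib_right)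

lemma discrepancy_oscillation:
  assumes "has_slope w \<alpha>"
  shows "discrepancy \<alpha> w m \<le> discrepancy \<alpha> w n + 1"
proof -
  have dist: "\<bar>real (ones w i l) - real l * \<alpha>\<bar> \<le> 1" for i l
  proof -
    obtain c where "c \<le> ones w i l" "ones w i l \<le> c + 1"
      "real c \<le> real l * \<alpha>" "real l * \<alpha> \<le> real c + 1"
      using assms unfolding has_slope_def by blast
    then show ?thesis by linarith
  qed
  show ?thesis
  proof (cases "n \<le> m")
    case True
    then show ?thesis
      using discrepancy_add [of \<alpha> w n "m - n"] dist [of n "m - n"] by simp
  next
    case False
    then show ?thesis
      using discrepancy_add [of \<alpha> w m "n - m"] dist [of m "n - m"] by simp
  qed
qed

section \<open>Irrationality of the slope\<close>

text \<open>If \<open>D\<close> is monotone along every residue class modulo \<open>q\<close>, two unit steps in the same class would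
  add up to a change of 2, against the oscillation bound. So each class contains at most one unit
  step. The sign \<open>s\<close> lets the lemma cover both directions of monotonicity.\<close>

lemma finite_deviant_windows:
  fixes s :: real
  assumes slope: "has_slope w \<alpha>" and "q > 0" and s: "\<bar>s\<bar> = 1"
    and monotone: "\<And>m. s * discrepancy \<alpha> w m \<le> s * discrepancy \<alpha> w (m + q)"
  shows "finite {m. s * discrepancy \<alpha> w m + 1 \<le> s * discrepancy \<alpha> w (m + q)}"
    (is "finite ?B")
proof -
  let ?D = "\<lambda>m. s * discrepancy \<alpha> w m"
  have osc: "?D m \<le> ?D n + 1" for m n
    using s discrepancy_oscillation [OF slope, of m n] discrepancy_oscillation [OF slope, of n m]
    by (cases "s \<ge> 0") auto
  have steps: "?D m \<le> ?D (m + j * q)" for m j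
  proof (induction j)
    case (Suc j)
    then show ?case
      using monotone [of "m + j * q"] by (simp add: algebra_simps)
  qed simp
  have no_two: False if "m \<in> ?B" "m' \<in> ?B" "m < m'" "m mod q = m' mod q" for m m'
  proof -
    have "q dvd m' - m"
      using that by (metis less_imp_le mod_eq_dvd_iff_nat)
    then obtain j where "m' - m = q * j" ..
    then have "m' = m + j * q"
      using \<open>m < m'\<close> by (simp add: mult.commute)
    moreover from this \<open>m < m'\<close> obtain i where "j = Suc i"
      by (cases j) auto
    ultimately have "m' = (m + q) + i * q" by simp
    then have "?D (m + q) \<le> ?D m'"
      using steps [of "m + q" i] by simp
    then have "?D m + 2 \<le> ?D (m' + q)"
      using that by simp
    then show False
      using osc [of "m' + q" m] by simp
  qed
  have "inj_on (\<lambda>m. m mod q) ?B"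
  proof (rule inj_onI)
    fix m m'
    assume *: "m \<in> ?B" "m' \<in> ?B" "m mod q = m' mod q"
    show "m = m'"
      using no_two [OF *(1,2) _ *(3)] no_two [OF *(2,1) _ *(3) [symmetric]]
      by (metis linorder_neqE_nat)
  qed
  moreover have "(\<lambda>m. m mod q) ` ?B \<subseteq> {..<q}"
    using \<open>q > 0\<close> by auto
  ultimately show ?thesis
    by (meson finite_imageD finite_lessThan finite_subset)
qed

text \<open>For \<open>q * \<alpha> = p\<close> with \<open>p\<close> an integer, windows of length \<open>q\<close> have \<open>p\<close> ones or a second value that
  lies always above or always below \<open>p\<close>. The second value makes \<open>D\<close> take a unit step, which
  happens only finitely often. Once all windows of length \<open>q\<close> have \<open>p\<close> ones, sliding such a
  window by one letter shows that the letter dropped equals the letter gained.\<close>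

lemma rational_slope_imp_ultimately_periodic:
  assumes slope: "has_slope w \<alpha>" and "\<alpha> \<in> \<rat>" and alphabet: "range w \<subseteq> {0, 1}"
  shows "ultimately_periodic w"
proof -
  obtain p q where "q \<noteq> 0" and pq: "\<bar>\<alpha>\<bar> = real p / real q"
    using Rats_abs_nat_div_natE [OF \<open>\<alpha> \<in> \<rat>\<close>] by metis
  have "0 \<le> \<alpha>"
  proof -
    obtain c where "real c \<le> real 1 * \<alpha>"
      using slope unfolding has_slope_def by blast
    then show ?thesis by simp
  qed
  then have p: "real q * \<alpha> = real p"
    using pq \<open>q \<noteq> 0\<close> by simp
  obtain c where c: "\<And>m. c \<le> ones w m q \<and> ones w m q \<le> c + 1"
    "real c \<le> real q * \<alpha>" "real q * \<alpha> \<le> real c + 1"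
    using slope unfolding has_slope_def by blast
  have "p = c \<or> p = c + 1"
    using c p by linarith
  then have "finite {m. ones w m q \<noteq> p}"
  proof
    assume "p = c"
    have "finite {m. 1 * discrepancy \<alpha> w m + 1 \<le> 1 * discrepancy \<alpha> w (m + q)}"
      by (rule finite_deviant_windows [OF slope])
        (use \<open>q \<noteq> 0\<close> c(1) \<open>p = c\<close> p in \<open>auto simp: discrepancy_add\<close>)
    moreover have "{m. ones w m q \<noteq> p} \<subseteq>
        {m. 1 * discrepancy \<alpha> w m + 1 \<le> 1 * discrepancy \<alpha> w (m + q)}"
    proof clarsimp
      fix m
      assume "ones w m q \<noteq> p"
      then have "ones w m q = p + 1"
        using c(1) [of m] \<open>p = c\<close> by linarith
      then show "discrepancy \<alpha> w m + 1 \<le> discrepancy \<alpha> w (m + q)"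
        by (simp add: discrepancy_add p)
    qed
    ultimately show ?thesis
      by (rule rev_finite_subset)
  next
    assume "p = c + 1"
    have "finite {m. (- 1) * discrepancy \<alpha> w m + 1 \<le> (- 1) * discrepancy \<alpha> w (m + q)}"
    proof (rule finite_deviant_windows [OF slope])
      show "(- 1) * discrepancy \<alpha> w m \<le> (- 1) * discrepancy \<alpha> w (m + q)" for m
        using c(1) [of m] \<open>p = c + 1\<close> p by (simp add: discrepancy_add)
    qed (use \<open>q \<noteq> 0\<close> in auto)
    moreover have "{m. ones w m q \<noteq> p} \<subseteq>
        {m. (- 1) * discrepancy \<alpha> w m + 1 \<le> (- 1) * discrepancy \<alpha> w (m + q)}"
    proof clarsimp
      fix m
      assume "ones w m q \<noteq> p"
      then have "p = ones w m q + 1"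
        using c(1) [of m] \<open>p = c + 1\<close> by linarith
      then show "1 - discrepancy \<alpha> w m \<le> - discrepancy \<alpha> w (m + q)"
        by (simp add: discrepancy_add p)
    qed
    ultimately show ?thesis
      by (rule rev_finite_subset)
  qed
  then obtain N where N: "\<And>m. m \<ge> N \<Longrightarrow> ones w m q = p"
    using finite_nat_set_iff_bounded by (metis (mono_tags, lifting) mem_Collect_eq not_less)
  have "w (n + q) = w n" if "n \<ge> N" for n
  proof -
    \<comment> \<open>Count the ones among the \<open>q + 1\<close> letters from \<open>n\<close> on by splitting off the last or the first.\<close>
    have "ones w n q + ones w (n + q) (Suc 0) = ones w n (Suc 0) + ones w (Suc n) q"
      by (metis One_nat_def Suc_eq_plus1 add.commute ones_add)
    then have "ones w (n + q) (Suc 0) = ones w n (Suc 0)"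
      using N [of n] N [of "Suc n"] that by simp
    moreover have "w i = 0 \<or> w i = 1" for i
      using alphabet by auto
    ultimately show ?thesis
      by (metis ones_Suc_0 zero_neq_one)
  qed
  then show ?thesis
    unfolding ultimately_periodic_def using \<open>q \<noteq> 0\<close> by blast
qed

section \<open>Runs of Abelian equivalent blocks\<close>

text \<open>Irrationality turns \<open>c \<le> l * \<alpha> \<le> c + 1\<close> into strict inequalities, so that \<open>c\<close> is the floor.\<close>

lemma irrational_slope_ones_bounds:
  assumes "has_slope w \<alpha>" and "\<alpha> \<notin> \<rat>" and "l > 0"
  shows "\<lfloor>real l * \<alpha>\<rfloor> \<le> int (ones w m l)" and "int (ones w m l) \<le> \<lfloor>real l * \<alpha>\<rfloor> + 1"
proof -
  obtain c where c: "c \<le> ones w m l" "ones w m l \<le> c + 1"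
    "real c \<le> real l * \<alpha>" "real l * \<alpha> \<le> real c + 1"
    using assms(1) unfolding has_slope_def by blast
  have "real l * \<alpha> \<noteq> real c + 1"
  proof
    assume "real l * \<alpha> = real c + 1"
    then have "\<alpha> = (real c + 1) / real l"
      using \<open>l > 0\<close> by (simp add: field_simps)
    then show False
      using \<open>\<alpha> \<notin> \<rat>\<close> by auto
  qed
  then have "\<lfloor>real l * \<alpha>\<rfloor> = int c"
    using c by (intro floor_unique) auto
  then show "\<lfloor>real l * \<alpha>\<rfloor> \<le> int (ones w m l)" "int (ones w m l) \<le> \<lfloor>real l * \<alpha>\<rfloor> + 1"
    using c by auto
qed

text \<open>If the counts differ, some block is heavy. The blocks before it lower the discrepancy by at most
  \<open>frac (l * \<alpha>)\<close> each, and the heavy block raises it by \<open>1 - frac (l * \<alpha>)\<close>.\<close>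

lemma unequal_blocks_imp_rise:
  assumes "has_slope w \<alpha>" and "\<alpha> \<notin> \<rat>" and "l > 0"
    and fail: "\<not> (\<forall>i<k. \<forall>j<k. ones w (n + i * l) l = ones w (n + j * l) l)"
  shows "\<exists>m. discrepancy \<alpha> w n + 1 - real k * frac (real l * \<alpha>) \<le> discrepancy \<alpha> w m"
proof -
  note bounds = irrational_slope_ones_bounds [OF assms(1-3)]
  have drift: "discrepancy \<alpha> w n - real i * frac (real l * \<alpha>) \<le> discrepancy \<alpha> w (n + i * l)" for i
  proof (induction i)
    case (Suc i)
    have "discrepancy \<alpha> w (n + Suc i * l) = discrepancy \<alpha> w ((n + i * l) + l)"
      by (simp add: algebra_simps)
    also have "\<dots> \<ge> discrepancy \<alpha> w (n + i * l) - frac (real l * \<alpha>)"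
      using bounds(1) [of "n + i * l"] unfolding discrepancy_add frac_def by linarith
    finally show ?case using Suc by (simp add: algebra_simps)
  qed simp
  obtain i where "i < k" and "int (ones w (n + i * l) l) \<noteq> \<lfloor>real l * \<alpha>\<rfloor>"
    using fail by (metis of_nat_eq_iff)
  then have heavy: "int (ones w (n + i * l) l) = \<lfloor>real l * \<alpha>\<rfloor> + 1"
    using bounds [of "n + i * l"] by linarith
  have "discrepancy \<alpha> w ((n + i * l) + l) = discrepancy \<alpha> w (n + i * l) + 1 - frac (real l * \<alpha>)"
    using heavy unfolding discrepancy_add frac_def by linarith
  moreover have "real (Suc i) * frac (real l * \<alpha>) \<le> real k * frac (real l * \<alpha>)"
    using \<open>i < k\<close> by (intro mult_right_mono) auto
  ultimately show ?thesis
    using drift [of i] by (intro exI [of _ "(n + i * l) + l"]) (simp add: algebra_simps)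
qed

text \<open>The mirror image: each block raises the discrepancy by at most \<open>1 - frac (l * \<alpha>)\<close>, while some
  light block lowers it by \<open>frac (l * \<alpha>)\<close>, which is large when \<open>l * \<alpha>\<close> is just below an integer.\<close>

lemma unequal_blocks_imp_fall:
  assumes "has_slope w \<alpha>" and "\<alpha> \<notin> \<rat>" and "l > 0"
    and fail: "\<not> (\<forall>i<k. \<forall>j<k. ones w (n + i * l) l = ones w (n + j * l) l)"
  shows "\<exists>m. discrepancy \<alpha> w m \<le> discrepancy \<alpha> w n - 1 + real k * (1 - frac (real l * \<alpha>))"
proof -
  note bounds = irrational_slope_ones_bounds [OF assms(1-3)]
  let ?d = "1 - frac (real l * \<alpha>)"
  have drift: "discrepancy \<alpha> w (n + i * l) \<le> discrepancy \<alpha> w n + real i * ?d" for i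
  proof (induction i)
    case (Suc i)
    have "discrepancy \<alpha> w (n + Suc i * l) = discrepancy \<alpha> w ((n + i * l) + l)"
      by (simp add: algebra_simps)
    also have "\<dots> \<le> discrepancy \<alpha> w (n + i * l) + ?d"
      using bounds(2) [of "n + i * l"] unfolding discrepancy_add frac_def by linarith
    finally show ?case using Suc by (simp add: algebra_simps)
  qed simp
  obtain i where "i < k" and "int (ones w (n + i * l) l) \<noteq> \<lfloor>real l * \<alpha>\<rfloor> + 1"
    using fail by (metis of_nat_eq_iff)
  then have light: "int (ones w (n + i * l) l) = \<lfloor>real l * \<alpha>\<rfloor>"
    using bounds [of "n + i * l"] by linarith
  have "discrepancy \<alpha> w ((n + i * l) + l) = discrepancy \<alpha> w (n + i * l) - 1 + ?d"
    using light unfolding discrepancy_add frac_def by linarith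
  moreover have "real (Suc i) * ?d \<le> real k * ?d"
    using \<open>i < k\<close> frac_lt_1 [of "real l * \<alpha>"] by (intro mult_right_mono) auto
  ultimately show ?thesis
    using drift [of i] by (intro exI [of _ "(n + i * l) + l"]) (simp add: algebra_simps)
qed

lemma concat_consecutive_blocks:
  "concat (map (\<lambda>i. w [n + i * l \<rightarrow> n + i * l + l]) [0..<k]) = w [n \<rightarrow> n + k * l]"
proof (induction k)
  case (Suc k)
  have "w [n \<rightarrow> n + Suc k * l] = w [n \<rightarrow> n + k * l] @ w [n + k * l \<rightarrow> n + k * l + l]"
    using upt_add_eq_append [of n "n + k * l" l]
    by (simp add: subsequence_def add.assoc add.commute [of l])
  then show ?case using Suc by simp
qed (simp add: subsequence_def)

lemma binary_abelian_equivalentI: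
  assumes "set u \<subseteq> {0, 1}" and "set v \<subseteq> {0, 1}" and "length u = length v"
    and "count_list u 1 = count_list v (1::nat)"
  shows "abelian_equivalent u v"
proof -
  have total: "count_list x 0 + count_list x 1 = length x" if "set x \<subseteq> {0, 1}" for x :: "nat list"
    using that by (induction x) auto
  have "count_list u a = count_list v a" for a
  proof (cases "a \<in> {0, 1}")
    case True
    then show ?thesis
      using total [OF assms(1)] total [OF assms(2)] assms(3,4) by auto
  next
    case False
    then have "a \<notin> set u" "a \<notin> set v"
      using assms(1,2) by blast+
    then show ?thesis
      by (simp add: count_list_0_iff)
  qed
  then show ?thesis
    unfolding abelian_equivalent_def by blast
qed

lemma equal_blocks_imp_abelian_power:
  assumes alphabet: "range w \<subseteq> {0, 1}" and "l > 0" and "k > 0"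
    and eq: "\<forall>i<k. \<forall>j<k. ones w (n + i * l) l = ones w (n + j * l) l"
  shows "abelian_power_period k l (w [n \<rightarrow> n + k * l])"
proof -
  let ?us = "map (\<lambda>i. w [n + i * l \<rightarrow> n + i * l + l]) [0..<k]"
  have "abelian_equivalent (w [n + i * l \<rightarrow> n + i * l + l]) (w [n + j * l \<rightarrow> n + j * l + l])"
    if "i < k" "j < k" for i j
  proof (rule binary_abelian_equivalentI)
    show "count_list (w [n + i * l \<rightarrow> n + i * l + l]) 1 = count_list (w [n + j * l \<rightarrow> n + j * l + l]) 1"
      using eq that unfolding ones_def by blast
  qed (use alphabet in \<open>simp_all add: image_subset_iff\<close>)
  then have "abelian_factorization k ?us (w [n \<rightarrow> n + k * l])"
    unfolding abelian_factorization_def concat_consecutive_blocks by auto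
  moreover have "length (hd ?us) = l"
    using \<open>k > 0\<close> by (simp add: hd_map)
  ultimately show ?thesis
    unfolding abelian_power_period_def using \<open>l > 0\<close> \<open>k > 0\<close> by auto
qed

lemma begins_in_abelian_powerI:
  assumes "occurs_at x w 0" and "abelian_power_period k l x"
  shows "begins_in_abelian_power k w"
  using assms
  unfolding occurs_at_def begins_in_abelian_power_def abelian_power_def abelian_power_period_def
  by metis

theorem theorem9:
  fixes \<omega> :: "nat word" and k :: nat
  assumes "sturmian \<omega>" and "k > 0"
  shows "(\<exists>l1>0. \<exists>l2>0. \<forall>n. \<exists>x. occurs_at x \<omega> n \<and>
            (abelian_power_period k l1 x \<or> abelian_power_period k l2 x)) \<and>
         begins_in_abelian_power k \<omega>"
proof -
  from \<open>sturmian \<omega>\<close> have alphabet: "range \<omega> \<subseteq> {0, 1}"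
    and aperiodic: "\<not> ultimately_periodic \<omega>" and "balanced \<omega>"
    by (auto simp: sturmian_def)
  obtain \<alpha> where slope: "has_slope \<omega> \<alpha>"
    using \<open>balanced \<omega>\<close> by (rule balanced_imp_has_slope)
  have irrational: "\<alpha> \<notin> \<rat>"
    using rational_slope_imp_ultimately_periodic [OF slope _ alphabet] aperiodic by blast
  have "1 / (2 * real k) > 0"
    using \<open>k > 0\<close> by simp
  then obtain l1 where "l1 > 0" and "\<bar>frac (real l1 * \<alpha>) - 0\<bar> < 1 / (2 * real k)"
    using Kronecker_approx_1_explicit [OF irrational, of 0 "1 / (2 * real k)"] by auto
  then have l1: "real k * frac (real l1 * \<alpha>) < 1 / 2"
    using \<open>k > 0\<close> by (simp add: field_simps)
  obtain l2 where "l2 > 0" and "\<bar>frac (real l2 * \<alpha>) - 1\<bar> < 1 / (2 * real k)"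
    using Kronecker_approx_1_explicit [OF irrational, of 1 "1 / (2 * real k)"]
      \<open>1 / (2 * real k) > 0\<close> by auto
  then have "1 - frac (real l2 * \<alpha>) < 1 / (2 * real k)"
    by linarith
  then have l2: "real k * (1 - frac (real l2 * \<alpha>)) < 1 / 2"
    using \<open>k > 0\<close> by (simp add: field_simps)
  have "\<exists>x. occurs_at x \<omega> n \<and> (abelian_power_period k l1 x \<or> abelian_power_period k l2 x)" for n
  proof -
    let ?eq = "\<lambda>l. \<forall>i<k. \<forall>j<k. ones \<omega> (n + i * l) l = ones \<omega> (n + j * l) l"
    have "?eq l1 \<or> ?eq l2"
    \<comment> \<open>Otherwise the discrepancy varies by at least \<open>2\<close> minus two terms below \<open>1/2\<close>.\<close>
    proof (rule ccontr)
      assume "\<not> (?eq l1 \<or> ?eq l2)"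
      then have fail1: "\<not> ?eq l1" and fail2: "\<not> ?eq l2"
        by blast+
      obtain m where "discrepancy \<alpha> \<omega> n + 1 - real k * frac (real l1 * \<alpha>) \<le> discrepancy \<alpha> \<omega> m"
        using unequal_blocks_imp_rise [OF slope irrational \<open>l1 > 0\<close> fail1] by blast
      moreover obtain m' where
        "discrepancy \<alpha> \<omega> m' \<le> discrepancy \<alpha> \<omega> n - 1 + real k * (1 - frac (real l2 * \<alpha>))"
        using unequal_blocks_imp_fall [OF slope irrational \<open>l2 > 0\<close> fail2] by blast
      ultimately show False
        using l1 l2 discrepancy_oscillation [OF slope, of m m'] by linarith
    qed
    then obtain l where "l \<in> {l1, l2}" and "?eq l"
      by blast
    then have "abelian_power_period k l (\<omega> [n \<rightarrow> n + k * l])"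
      using equal_blocks_imp_abelian_power [OF alphabet _ \<open>k > 0\<close>] \<open>l1 > 0\<close> \<open>l2 > 0\<close> by blast
    moreover have "occurs_at (\<omega> [n \<rightarrow> n + k * l]) \<omega> n"
      by (simp add: occurs_at_def)
    ultimately show ?thesis
      using \<open>l \<in> {l1, l2}\<close> by blast
  qed
  moreover from this have "begins_in_abelian_power k \<omega>"
    using begins_in_abelian_powerI by blast
  ultimately show ?thesis
    using \<open>l1 > 0\<close> \<open>l2 > 0\<close> by blast
qed

end
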